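(* Let $a=0$, $b\in(2,\infty)$, $f\equiv 1$, and let $x_0\in C^{2+\beta}([0,b])$ for some $\beta\in(0,1)$ satisfy $x_0(0)=-1$, $x_0(b)=1$, $x_{0uu}(0)=0$, $x_{0uu}(b)=b$ (that is, $x_{0uu}(a)=a$, $x_{0uu}(b)=b$ with $a=0$) and $x_{0u}>0$ in $[0,b]$. Let $x$ be the global solution, constructed as described in the context, of $$x_t=\frac{x_{uu}-1}{x_u^2}\ \text{ in }(0,b)\times(0,\infty),\qquad x(0,t)=-1,\ x(b,t)=1\ (t>0),\qquad x(\cdot,0)=x_0\ \text{ in }[0,b].$$ Then $$t_0:=\inf\{t>0\mid \exists\,u\in[0,b]:\ x_u(u,t)=0\}\in(0,\infty)\qquad\text{and}\qquad x_u(0,t_0)=0 .$$ Moreover, for large $t$, the image of $[0,b]$ under $x(\cdot,t)$ contains negative elements.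
   Context: Subscripts $u,t$ denote (weak) partial derivatives. For $\varepsilon>0$ let $x_\varepsilon$ denote the unique classical solution of the regularized problem $$x_{\varepsilon t}=\frac{x_{\varepsilon uu}-1}{x_{\varepsilon u}^2+\varepsilon}\ \text{ in }(0,b)\times(0,\infty),\quad x_\varepsilon(0,t)=-1,\ x_\varepsilon(b,t)=1\ (t>0),\quad x_\varepsilon(\cdot,0)=x_0 .$$ The constructed solution is a function $x$ obtained as a limit along a sequence $\varepsilon_k\searrow0$, such that, for any $p\in(1,\infty)$ and $\alpha\in(0,1)$: $x_{\varepsilon_k}\to x$ in $C^0_{loc}([0,\infty);C^{1+\alpha}([0,b]))$, $x_{\varepsilon_k uu}\rightharpoonup x_{uu}$ weakly in $L^p_{loc}([0,b]\times[0,\infty))$, and $x_{\varepsilon_k t}\to x_t$ weak-$*$ in $L^\infty((0,b)\times(0,\infty))$. It solves the problem in the claim in the weak sense that $\int_0^\infty\int_0^b x_u^2x_t\varphi=-\int_0^\infty\int_0^b x_u\varphi_u-\int_0^\infty\int_0^b \varphi$ for all $\varphi\in C_c^\infty((0,b)\times(0,\infty))$, together with $x(0,t)=-1$, $x(b,t)=1$ for every $t>0$ and $x(\cdot,0)=x_0$. *)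

theory Defs
  imports "HOL-Analysis.Analysis"
begin

text \<open>
  Functions of \<open>(u, t)\<close> are maps on \<^typ>\<open>real \<times> real\<close> with the space variable \<open>u\<close> first; their values
  outside \<open>[0, b] \<times> [0, \<infinity>)\<close> are irrelevant.
\<close>

definition space_time :: "real \<Rightarrow> (real \<times> real) set" where
  "space_time b = {0<..<b} \<times> {0<..}"

text \<open>Derivative on \<open>[0, b]\<close>, one-sided at the two end points.\<close>

definition D :: "real \<Rightarrow> (real \<Rightarrow> real) \<Rightarrow> real \<Rightarrow> real" where
  "D b g u = vector_derivative g (at u within {0..b})"

definition D\<^sub>u :: "real \<Rightarrow> (real \<times> real \<Rightarrow> real) \<Rightarrow> real \<times> real \<Rightarrow> real" where
  "D\<^sub>u b f = (\<lambda>(u, t). D b (\<lambda>v. f (v, t)) u)"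

definition D\<^sub>t :: "(real \<times> real \<Rightarrow> real) \<Rightarrow> real \<times> real \<Rightarrow> real" where
  "D\<^sub>t f = (\<lambda>(u, t). deriv (\<lambda>s. f (u, s)) t)"


section \<open>Hoelder spaces on $[0,b]$\<close>

text \<open>
  The norm takes values in \<^typ>\<open>ennreal\<close>, so that suprema of unbounded quantities are \<open>\<infinity>\<close>.
  For \<open>0 < \<alpha>\<close>, finiteness of the seminorm makes the \<open>k\<close>-th derivative continuous.
\<close>

definition holder_norm :: "real \<Rightarrow> nat \<Rightarrow> real \<Rightarrow> (real \<Rightarrow> real) \<Rightarrow> ennreal" where
  "holder_norm b k \<alpha> g =
     (\<Sum>j\<le>k. SUP u\<in>{0..b}. ennreal \<bar>(D b ^^ j) g u\<bar>) +
     (SUP u\<in>{0..b}. SUP v\<in>{0..b} - {u}.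
        ennreal (\<bar>(D b ^^ k) g u - (D b ^^ k) g v\<bar> / \<bar>u - v\<bar> powr \<alpha>))"

definition holder_space :: "real \<Rightarrow> nat \<Rightarrow> real \<Rightarrow> (real \<Rightarrow> real) set" where
  "holder_space b k \<alpha> =
     {g. (\<forall>j<k. (D b ^^ j) g differentiable_on {0..b}) \<and> holder_norm b k \<alpha> g < \<infinity>}"

text \<open>Membership and convergence in $C^0_{loc}([0,\infty); C^{k+\alpha}([0,b]))$.\<close>

definition C0_holder :: "real \<Rightarrow> nat \<Rightarrow> real \<Rightarrow> (real \<times> real \<Rightarrow> real) set" where
  "C0_holder b k \<alpha> =
     {f. \<forall>t\<ge>0. (\<lambda>u. f (u, t)) \<in> holder_space b k \<alpha> \<and>
        ((\<lambda>s. holder_norm b k \<alpha> (\<lambda>u. f (u, s) - f (u, t))) \<longlongrightarrow> 0) (at t within {0..})}"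

definition C0_holder_tendsto ::
  "real \<Rightarrow> nat \<Rightarrow> real \<Rightarrow> (nat \<Rightarrow> real \<times> real \<Rightarrow> real) \<Rightarrow> (real \<times> real \<Rightarrow> real) \<Rightarrow> bool" where
  "C0_holder_tendsto b k \<alpha> f g \<longleftrightarrow>
     (\<forall>n. f n \<in> C0_holder b k \<alpha>) \<and> g \<in> C0_holder b k \<alpha> \<and>
     (\<forall>T>0. (\<lambda>n. SUP t\<in>{0..T}. holder_norm b k \<alpha> (\<lambda>u. f n (u, t) - g (u, t))) \<longlonglongrightarrow> 0)"


section \<open>Lebesgue spaces and weak convergence\<close>

definition Lp_space :: "(real \<times> real) set \<Rightarrow> real \<Rightarrow> (real \<times> real \<Rightarrow> real) set" where
  "Lp_space S p =
     {f \<in> borel_measurable (lebesgue_on S). integrable (lebesgue_on S) (\<lambda>z. \<bar>f z\<bar> powr p)}"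

definition Linf_space :: "(real \<times> real) set \<Rightarrow> (real \<times> real \<Rightarrow> real) set" where
  "Linf_space S =
     {f \<in> borel_measurable (lebesgue_on S). \<exists>C. AE z in lebesgue_on S. \<bar>f z\<bar> \<le> C}"

definition Lp_weak_tendsto ::
  "(real \<times> real) set \<Rightarrow> real \<Rightarrow> (nat \<Rightarrow> real \<times> real \<Rightarrow> real) \<Rightarrow> (real \<times> real \<Rightarrow> real) \<Rightarrow> bool" where
  "Lp_weak_tendsto S p f g \<longleftrightarrow>
     (\<forall>n. f n \<in> Lp_space S p) \<and> g \<in> Lp_space S p \<and>
     (\<forall>\<psi>\<in>Lp_space S (p / (p - 1)).
        (\<lambda>n. LINT z|lebesgue_on S. f n z * \<psi> z) \<longlonglongrightarrow> (LINT z|lebesgue_on S. g z * \<psi> z))"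

definition Linf_weakstar_tendsto ::
  "(real \<times> real) set \<Rightarrow> (nat \<Rightarrow> real \<times> real \<Rightarrow> real) \<Rightarrow> (real \<times> real \<Rightarrow> real) \<Rightarrow> bool" where
  "Linf_weakstar_tendsto S f g \<longleftrightarrow>
     (\<forall>n. f n \<in> Linf_space S) \<and> g \<in> Linf_space S \<and>
     (\<forall>\<psi>\<in>Lp_space S 1.
        (\<lambda>n. LINT z|lebesgue_on S. f n z * \<psi> z) \<longlonglongrightarrow> (LINT z|lebesgue_on S. g z * \<psi> z))"


section \<open>Test functions and weak derivatives\<close>

primrec Ck :: "nat \<Rightarrow> (real \<times> real \<Rightarrow> real) \<Rightarrow> bool" where
  "Ck 0 \<phi> \<longleftrightarrow> continuous_on UNIV \<phi>"
| "Ck (Suc k) \<phi> \<longleftrightarrow>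
     (\<exists>\<phi>u \<phi>t.
        (\<forall>u t. ((\<lambda>v. \<phi> (v, t)) has_real_derivative \<phi>u (u, t)) (at u)) \<and>
        (\<forall>u t. ((\<lambda>s. \<phi> (u, s)) has_real_derivative \<phi>t (u, t)) (at t)) \<and>
        Ck k \<phi>u \<and> Ck k \<phi>t)"

text \<open>$C_c^\infty(S)$, each function being extended by zero to the whole plane.\<close>

definition test_functions :: "(real \<times> real) set \<Rightarrow> (real \<times> real \<Rightarrow> real) set" where
  "test_functions S =
     {\<phi>. (\<forall>k. Ck k \<phi>) \<and> (\<exists>K. compact K \<and> K \<subseteq> S \<and> (\<forall>z. z \<notin> K \<longrightarrow> \<phi> z = 0))}"

definition L1_loc :: "(real \<times> real) set \<Rightarrow> (real \<times> real \<Rightarrow> real) set" where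
  "L1_loc S = {f. \<forall>K. compact K \<and> K \<subseteq> S \<longrightarrow> integrable (lebesgue_on K) f}"

definition weak_D\<^sub>u :: "real \<Rightarrow> (real \<times> real \<Rightarrow> real) \<Rightarrow> (real \<times> real \<Rightarrow> real) \<Rightarrow> bool" where
  "weak_D\<^sub>u b f g \<longleftrightarrow>
     f \<in> L1_loc (space_time b) \<and> g \<in> L1_loc (space_time b) \<and>
     (\<forall>\<phi>\<in>test_functions (space_time b).
        (LINT z|lebesgue_on (space_time b). f z * D\<^sub>u b \<phi> z) =
        - (LINT z|lebesgue_on (space_time b). g z * \<phi> z))"

definition weak_D\<^sub>t :: "real \<Rightarrow> (real \<times> real \<Rightarrow> real) \<Rightarrow> (real \<times> real \<Rightarrow> real) \<Rightarrow> bool" where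
  "weak_D\<^sub>t b f g \<longleftrightarrow>
     f \<in> L1_loc (space_time b) \<and> g \<in> L1_loc (space_time b) \<and>
     (\<forall>\<phi>\<in>test_functions (space_time b).
        (LINT z|lebesgue_on (space_time b). f z * D\<^sub>t \<phi> z) =
        - (LINT z|lebesgue_on (space_time b). g z * \<phi> z))"


section \<open>The regularized problem and the constructed solution\<close>

definition initial_boundary_conditions ::
  "real \<Rightarrow> (real \<Rightarrow> real) \<Rightarrow> (real \<times> real \<Rightarrow> real) \<Rightarrow> bool" where
  "initial_boundary_conditions b x\<^sub>0 x \<longleftrightarrow>
     (\<forall>t>0. x (0, t) = -1 \<and> x (b, t) = 1) \<and> (\<forall>u\<in>{0..b}. x (u, 0) = x\<^sub>0 u)"

text \<open>
  Classical solutions are continuous on $[0,b]\times[0,\infty)$ and $C^{2,1}$ in the open set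
  $(0,b)\times(0,\infty)$, the class in which the comparison principle gives uniqueness.
  Smoothness at $t=0$ up to the corners must not be required: there the boundary data give
  $x_t=0$, whereas \<open>x\<^sub>0''(0) = 0\<close> and \<open>x\<^sub>0''(b) = b\<close> give $x_t\neq0$ in the equation.
\<close>

definition classical_solution ::
  "real \<Rightarrow> real \<Rightarrow> (real \<Rightarrow> real) \<Rightarrow> (real \<times> real \<Rightarrow> real) \<Rightarrow> bool" where
  "classical_solution b \<epsilon> x\<^sub>0 y \<longleftrightarrow>
     continuous_on ({0..b} \<times> {0..}) y \<and>
     (\<forall>(u, t)\<in>space_time b.
        (\<lambda>v. y (v, t)) differentiable (at u) \<and>
        (\<lambda>v. D\<^sub>u b y (v, t)) differentiable (at u) \<and>
        (\<lambda>s. y (u, s)) differentiable (at t)) \<and>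
     continuous_on (space_time b) (D\<^sub>u b y) \<and>
     continuous_on (space_time b) (D\<^sub>u b (D\<^sub>u b y)) \<and>
     continuous_on (space_time b) (D\<^sub>t y) \<and>
     (\<forall>z\<in>space_time b. D\<^sub>t y z = (D\<^sub>u b (D\<^sub>u b y) z - 1) / ((D\<^sub>u b y z)\<^sup>2 + \<epsilon>)) \<and>
     initial_boundary_conditions b x\<^sub>0 y"

definition weak_solution ::
  "real \<Rightarrow> (real \<Rightarrow> real) \<Rightarrow> (real \<times> real \<Rightarrow> real) \<Rightarrow> (real \<times> real \<Rightarrow> real) \<Rightarrow> bool" where
  "weak_solution b x\<^sub>0 x x\<^sub>t \<longleftrightarrow>
     (\<forall>\<phi>\<in>test_functions (space_time b).
        (LINT z|lebesgue_on (space_time b). (D\<^sub>u b x z)\<^sup>2 * x\<^sub>t z * \<phi> z) =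
        - (LINT z|lebesgue_on (space_time b). D\<^sub>u b x z * D\<^sub>u b \<phi> z)
        - (LINT z|lebesgue_on (space_time b). \<phi> z)) \<and>
     initial_boundary_conditions b x\<^sub>0 x"

definition constructed_solution ::
  "real \<Rightarrow> (real \<Rightarrow> real) \<Rightarrow> (real \<times> real \<Rightarrow> real) \<Rightarrow> bool" where
  "constructed_solution b x\<^sub>0 x \<longleftrightarrow>
     (\<exists>\<epsilon> y x\<^sub>u\<^sub>u x\<^sub>t.
        (\<forall>k. 0 < \<epsilon> k) \<and> decseq \<epsilon> \<and> \<epsilon> \<longlonglongrightarrow> 0 \<and>
        (\<forall>k. classical_solution b (\<epsilon> k) x\<^sub>0 (y k)) \<and>
        weak_D\<^sub>u b (D\<^sub>u b x) x\<^sub>u\<^sub>u \<and> weak_D\<^sub>t b x x\<^sub>t \<and>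
        (\<forall>\<alpha>\<in>{0<..<1}. C0_holder_tendsto b 1 \<alpha> y x) \<and>
        (\<forall>p\<in>{1<..}. \<forall>T>0.
           Lp_weak_tendsto ({0<..<b} \<times> {0<..<T}) p (\<lambda>k. D\<^sub>u b (D\<^sub>u b (y k))) x\<^sub>u\<^sub>u) \<and>
        Linf_weakstar_tendsto (space_time b) (\<lambda>k. D\<^sub>t (y k)) x\<^sub>t \<and>
        weak_solution b x\<^sub>0 x x\<^sub>t)"

end

theory Submission
  imports Defs
begin

text \<open>
  Everything rests on the elementary comparison principle for the regularized problem.
  With \<open>L = max x\<^sub>0'\<close>, the function \<open>2u\<^sup>2/b\<^sup>2 + (L - \<mu>t)u - 1\<close> is a supersolution for small \<open>\<mu>\<close>
  (here \<open>b > 2\<close> enters), uniformly in \<open>\<epsilon>\<close>; at \<open>t = L/\<mu>\<close> it forces \<open>x\<^sub>u(0,t) \<le> 0\<close>, so \<open>t\<^sub>0 < \<infinity>\<close>.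
  If \<open>x\<^sub>u(0,t\<^sub>0)\<close> were positive, then \<open>x\<^sub>u(0,\<cdot>)\<close> would be bounded below on \<open>[0,t\<^sub>0]\<close>. Since the equation is
  invariant under translations in \<open>u\<close>, one may compare \<open>y(u+h,t) - mh\<close> with \<open>y(u,t)\<close>: the ordering at
  \<open>u = 0\<close> is the assumed bound, and at \<open>u = b-h\<close> it follows from the linear supersolution \<open>1 - m(b-u)\<close>.
  Hence \<open>x\<^sub>u \<ge> m > 0\<close> on \<open>[0,b] \<times> [0,t\<^sub>0]\<close>, a contradiction.
\<close>

section \<open>Derivatives on closed intervals\<close>

text \<open>If \<open>d\<close> were positive, \<open>f'\<close> would be positive just to the right
  of its zero \<open>u\<close>, so \<open>f\<close> would increase strictly there and exceed its
  maximum.\<close>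

lemma second_derivative_nonpos_at_max:
  fixes f f' :: "real \<Rightarrow> real"
  assumes u: "l < u" "u < r"
    and f: "\<And>v. l < v \<Longrightarrow> v < r \<Longrightarrow> (f has_real_derivative f' v) (at v)"
    and f': "(f' has_real_derivative d) (at u)"
    and max: "\<And>v. l < v \<Longrightarrow> v < r \<Longrightarrow> f v \<le> f u"
  shows "f' u = 0" "d \<le> 0"
proof -
  define e where "e = min (u - l) (r - u)"
  have e: "0 < e" using u by (auto simp: e_def)
  show 0: "f' u = 0"
    by (rule DERIV_local_max[OF f[OF u] e]) (auto simp: e_def abs_if intro!: max split: if_splits)
  show "d \<le> 0"
  proof (rule ccontr)
    assume "\<not> d \<le> 0"
    then obtain c where c: "0 < c" "\<And>h. 0 < h \<Longrightarrow> h < c \<Longrightarrow> f' u < f' (u + h)"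
      using DERIV_pos_inc_right[OF f'] by auto
    define h where "h = min c e / 2"
    have h: "0 < h" "h < c" "u + h < r"
      using c(1) e u by (auto simp: h_def e_def min_def field_simps)
    have "f u < f (u + h)"
    proof (rule DERIV_pos_imp_increasing_open[of u "u + h"])
      show "\<exists>y. (f has_real_derivative y) (at v) \<and> 0 < y" if "u < v" "v < u + h" for v
        using f[of v] c(2)[of "v - u"] that h u 0 by (intro exI[of _ "f' v"]) auto
      show "continuous_on {u..u + h} f"
        using h u by (intro DERIV_continuous_on[of _ _ f'] DERIV_subset[OF f]) auto
    qed (use h in auto)
    then show False using max[of "u + h"] h u by auto
  qed
qed

lemma difference_ge_of_derivative_ge:
  fixes f f' :: "real \<Rightarrow> real"
  assumes f: "\<And>u. u \<in> {0..b} \<Longrightarrow> (f has_real_derivative f' u) (at u within {0..b})"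
    and "0 \<le> l" "l \<le> r" "r \<le> b"
    and ge: "\<And>u. u \<in> {l..r} \<Longrightarrow> m \<le> f' u"
  shows "m * (r - l) \<le> f r - f l"
proof -
  have "\<exists>u\<in>{l..r}. f r - f l = f' u * (r - l)"
    using assms
    by (intro mvt_very_simple[of l r f "\<lambda>u. (*) (f' u)"])
      (auto simp flip: has_field_derivative_def intro!: DERIV_subset[OF f])
  then show ?thesis
    using ge \<open>l \<le> r\<close> by (auto intro!: mult_right_mono)
qed

lemma at_within_Icc_neq_bot:
  fixes u b :: real
  assumes "0 < b" "u \<in> {0..b}"
  shows "at u within {0..b} \<noteq> bot"
  using assms by (simp add: trivial_limit_within islimpt_Icc)

text \<open>Difference quotients from either side of \<open>u\<close> are increments over a step
  \<open>h\<close>, so a bound on all short increments, which comparison of translates supplies,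
  passes to the limit.\<close>

lemma derivative_ge_of_difference_ge:
  fixes f :: "real \<Rightarrow> real"
  assumes "0 < b" and u: "u \<in> {0..b}"
    and f: "(f has_real_derivative d) (at u within {0..b})"
    and "0 < h\<^sub>0"
    and ge: "\<And>h v. 0 < h \<Longrightarrow> h \<le> h\<^sub>0 \<Longrightarrow> 0 \<le> v \<Longrightarrow> v + h \<le> b \<Longrightarrow> m * h \<le> f (v + h) - f v"
  shows "m \<le> d"
proof (rule tendsto_lowerbound[OF f[unfolded has_field_derivative_iff]])
  show "\<forall>\<^sub>F v in at u within {0..b}. m \<le> (f v - f u) / (v - u)"
    unfolding eventually_at
  proof (intro exI[of _ h\<^sub>0] conjI ballI impI)
    fix v assume v: "v \<in> {0..b}" "v \<noteq> u \<and> dist v u < h\<^sub>0"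
    show "m \<le> (f v - f u) / (v - u)"
    proof (cases "u < v")
      case True
      then show ?thesis using ge[of "v - u" u] u v by (simp add: field_simps dist_real_def)
    next
      case False
      then have "v < u" using v by auto
      then show ?thesis using ge[of "u - v" v] u v by (simp add: field_simps dist_real_def)
    qed
  qed fact
qed (rule at_within_Icc_neq_bot[OF assms(1,2)])

lemma derivative_le_at_0:
  fixes f g :: "real \<Rightarrow> real"
  assumes "0 < b"
    and f: "(f has_real_derivative d) (at 0 within {0..b})"
    and g: "(g has_real_derivative d') (at 0 within {0..b})"
    and "f 0 = g 0" and le: "\<And>u. u \<in> {0..b} \<Longrightarrow> f u \<le> g u"
  shows "d \<le> d'"
proof (rule tendsto_le[OF _ g[unfolded has_field_derivative_iff] f[unfolded has_field_derivative_iff]])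
  show "\<forall>\<^sub>F v in at 0 within {0..b}. (f v - f 0) / (v - 0) \<le> (g v - g 0) / (v - 0)"
    unfolding eventually_at using assms(1,4) le
    by (intro exI[of _ 1]) (auto intro!: divide_right_mono)
qed (use at_within_Icc_neq_bot[OF assms(1)] assms(1) in auto)

section \<open>Comparison principle\<close>

text \<open>The derivatives are arguments so that translates and explicit barriers are covered
  without computing \<open>D\<^sub>u\<close>. The final time \<open>T\<close> belongs to the domain,
  with a two-sided time derivative there.\<close>

definition C21 ::
  "real \<Rightarrow> real \<Rightarrow> real \<Rightarrow> (real \<times> real \<Rightarrow> real) \<Rightarrow>
    (real \<times> real \<Rightarrow> real) \<Rightarrow> (real \<times> real \<Rightarrow> real) \<Rightarrow> (real \<times> real \<Rightarrow> real) \<Rightarrow> bool" where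
  "C21 l r T y yu yuu yt \<longleftrightarrow>
     continuous_on ({l..r} \<times> {0..T}) y \<and>
     (\<forall>u t. l < u \<and> u < r \<and> 0 < t \<and> t \<le> T \<longrightarrow>
        ((\<lambda>v. y (v, t)) has_real_derivative yu (u, t)) (at u) \<and>
        ((\<lambda>v. yu (v, t)) has_real_derivative yuu (u, t)) (at u) \<and>
        ((\<lambda>s. y (u, s)) has_real_derivative yt (u, t)) (at t))"

text \<open>Subtracting \<open>\<eta> * t\<close> makes the time inequality strict. At a positive
  maximum of the difference the slopes agree, so both sides carry the same coefficient, and the
  ordering of the second derivatives contradicts that of the time derivatives. The equation is kept
  in multiplied-out form to avoid division.\<close>

lemma comparison_principle:
  assumes y: "C21 l r T y yu yuu yt" and S: "C21 l r T S Su Suu St"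
    and "0 < \<epsilon>"
    and sub: "\<And>u t. l < u \<Longrightarrow> u < r \<Longrightarrow> 0 < t \<Longrightarrow> t \<le> T \<Longrightarrow>
      yt (u, t) * ((yu (u, t))\<^sup>2 + \<epsilon>) \<le> yuu (u, t) - 1"
    and super: "\<And>u t. l < u \<Longrightarrow> u < r \<Longrightarrow> 0 < t \<Longrightarrow> t \<le> T \<Longrightarrow>
      Suu (u, t) - 1 \<le> St (u, t) * ((Su (u, t))\<^sup>2 + \<epsilon>)"
    and init: "\<And>u. l \<le> u \<Longrightarrow> u \<le> r \<Longrightarrow> y (u, 0) \<le> S (u, 0)"
    and left: "\<And>t. 0 \<le> t \<Longrightarrow> t \<le> T \<Longrightarrow> y (l, t) \<le> S (l, t)"
    and right: "\<And>t. 0 \<le> t \<Longrightarrow> t \<le> T \<Longrightarrow> y (r, t) \<le> S (r, t)"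
    and ut: "u \<in> {l..r}" "t \<in> {0..T}"
  shows "y (u, t) \<le> S (u, t)"
proof (rule ccontr)
  assume "\<not> y (u, t) \<le> S (u, t)"
  then have pos: "0 < y (u, t) - S (u, t)" by simp
  \<comment> \<open>The penalty uses up at most half of the gap up to time \<open>T\<close>;
    \<open>T + 1\<close> keeps the denominator positive when \<open>T = 0\<close>.\<close>
  define \<eta> where "\<eta> = (y (u, t) - S (u, t)) / (2 * (T + 1))"
  have T: "0 \<le> T" using ut by auto
  have \<eta>: "0 < \<eta>" using pos T by (simp add: \<eta>_def)
  have "\<eta> * t \<le> \<eta> * (T + 1)" using \<eta> ut by (intro mult_left_mono) auto
  also have "\<dots> = (y (u, t) - S (u, t)) / 2" using T by (simp add: \<eta>_def field_simps)
  finally have \<eta>t: "\<eta> * t < y (u, t) - S (u, t)" using pos by simp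
  define w where "w z = y z - S z - \<eta> * snd z" for z
  have "continuous_on ({l..r} \<times> {0..T}) w"
    using y S unfolding w_def C21_def by (intro continuous_intros) auto
  moreover have "compact ({l..r} \<times> {0..T})" by (intro compact_Times compact_Icc)
  moreover have "(u, t) \<in> {l..r} \<times> {0..T}" using ut by auto
  ultimately obtain z where z: "z \<in> {l..r} \<times> {0..T}"
    and zmax: "\<forall>z'\<in>{l..r} \<times> {0..T}. w z' \<le> w z"
    using continuous_attains_sup[of "{l..r} \<times> {0..T}" w] by blast
  obtain p q where pq: "z = (p, q)" by (cases z)
  have max: "w (p', q') \<le> w (p, q)" if "p' \<in> {l..r}" "q' \<in> {0..T}" for p' q'
    using zmax that pq by auto
  have "0 < w (p, q)" using max[OF ut] \<eta>t by (simp add: w_def)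
  moreover have "0 \<le> \<eta> * q" using \<eta> z pq by auto
  ultimately have gt: "S (p, q) < y (p, q)" by (simp add: w_def)
  \<comment> \<open>The maximum avoids the parabolic boundary, where \<open>y\<close> is at most
    \<open>S\<close>.\<close>
  have "p \<noteq> l" "p \<noteq> r" "q \<noteq> 0"
    using gt left[of q] right[of q] init[of p] z pq by auto
  then have p: "l < p" "p < r" and q: "0 < q" "q \<le> T" using z pq by auto
  have space: "((\<lambda>v. w (v, q)) has_real_derivative (yu (v, q) - Su (v, q))) (at v)"
    if "l < v" "v < r" for v
    using y S that q unfolding C21_def w_def by (auto intro!: derivative_eq_intros)
  have space2: "((\<lambda>v. yu (v, q) - Su (v, q)) has_real_derivative (yuu (p, q) - Suu (p, q))) (at p)"
    using y S p q unfolding C21_def by (intro derivative_intros) auto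
  have time: "((\<lambda>s. w (p, s)) has_real_derivative (yt (p, q) - St (p, q) - \<eta>)) (at q)"
    using y S p q unfolding C21_def w_def by (auto intro!: derivative_eq_intros)
  note * = second_derivative_nonpos_at_max[OF p space space2]
  have yu: "yu (p, q) = Su (p, q)" using *(1) max p q by auto
  have yuu: "yuu (p, q) \<le> Suu (p, q)" using *(2) max p q by auto
  \<comment> \<open>Since \<open>q = T\<close> is possible, only earlier times are compared; they
    show that the time derivative of \<open>w\<close> is nonnegative.\<close>
  have yt: "St (p, q) + \<eta> \<le> yt (p, q)"
  proof (rule ccontr)
    assume "\<not> St (p, q) + \<eta> \<le> yt (p, q)"
    then obtain c where c: "0 < c" "\<And>h. 0 < h \<Longrightarrow> h < c \<Longrightarrow> w (p, q) < w (p, q - h)"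
      using DERIV_neg_dec_left[OF time] by auto
    define h where "h = min (c / 2) q"
    have "0 < h" "h < c" "h \<le> q" using c(1) q by (auto simp: h_def)
    then show False using c(2)[of h] max[of p "q - h"] p q by auto
  qed
  have P: "0 < (Su (p, q))\<^sup>2 + \<epsilon>" using \<open>0 < \<epsilon>\<close> by (simp add: add_nonneg_pos)
  have "St (p, q) * ((Su (p, q))\<^sup>2 + \<epsilon>) < yt (p, q) * ((Su (p, q))\<^sup>2 + \<epsilon>)"
    using yt \<eta> P by (intro mult_strict_right_mono) auto
  then show False using sub[OF p q] super[OF p q] yu yuu by simp
qed

section \<open>Barriers and translates for the regularized problem\<close>

lemma classical_solution_C21:
  assumes "classical_solution b \<epsilon> x\<^sub>0 y"
  shows "C21 0 b T y (D\<^sub>u b y) (D\<^sub>u b (D\<^sub>u b y)) (D\<^sub>t y)"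
  unfolding C21_def
proof (intro conjI allI impI)
  show "continuous_on ({0..b} \<times> {0..T}) y"
    using assms unfolding classical_solution_def by (auto elim!: continuous_on_subset)
next
  fix u t assume ut: "0 < u \<and> u < b \<and> 0 < t \<and> t \<le> T"
  then have "(u, t) \<in> space_time b" by (auto simp: space_time_def)
  then have diff: "(\<lambda>v. y (v, t)) differentiable (at u)"
      "(\<lambda>v. D\<^sub>u b y (v, t)) differentiable (at u)"
      "(\<lambda>s. y (u, s)) differentiable (at t)"
    using assms unfolding classical_solution_def by auto
  have D: "(g has_real_derivative D b g u) (at u)" if "g differentiable (at u)" for g
    using that ut at_within_Icc_at[of 0 u b]
    by (simp add: D_def vector_derivative_works has_real_derivative_iff_has_vector_derivative)
  show "((\<lambda>v. y (v, t)) has_real_derivative D\<^sub>u b y (u, t)) (at u)"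
    using D[OF diff(1)] by (simp add: D\<^sub>u_def)
  show "((\<lambda>v. D\<^sub>u b y (v, t)) has_real_derivative D\<^sub>u b (D\<^sub>u b y) (u, t)) (at u)"
    using D[OF diff(2)] by (simp add: D\<^sub>u_def[of b "D\<^sub>u b y"])
  show "((\<lambda>s. y (u, s)) has_real_derivative D\<^sub>t y (u, t)) (at t)"
    using diff(3) by (simp add: D\<^sub>t_def DERIV_deriv_iff_real_differentiable)
qed

lemma classical_solution_equation:
  assumes "classical_solution b \<epsilon> x\<^sub>0 y" "0 < \<epsilon>" "0 < u" "u < b" "0 < t"
  shows "D\<^sub>t y (u, t) * ((D\<^sub>u b y (u, t))\<^sup>2 + \<epsilon>) = D\<^sub>u b (D\<^sub>u b y) (u, t) - 1"
proof -
  have "D\<^sub>t y (u, t) = (D\<^sub>u b (D\<^sub>u b y) (u, t) - 1) / ((D\<^sub>u b y (u, t))\<^sup>2 + \<epsilon>)"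
    using assms unfolding classical_solution_def space_time_def by auto
  moreover have "(D\<^sub>u b y (u, t))\<^sup>2 + \<epsilon> \<noteq> 0"
    using \<open>0 < \<epsilon>\<close> by (metis add_nonneg_pos less_irrefl zero_le_power2)
  ultimately show ?thesis by simp
qed

lemma classical_solution_boundary:
  assumes "classical_solution b \<epsilon> x\<^sub>0 y" "0 \<le> b" "x\<^sub>0 0 = -1" "x\<^sub>0 b = 1" "0 \<le> t"
  shows "y (0, t) = -1" "y (b, t) = 1"
  using assms unfolding classical_solution_def initial_boundary_conditions_def
  by (cases "t = 0"; auto)+

lemma classical_solution_initial:
  assumes "classical_solution b \<epsilon> x\<^sub>0 y" "u \<in> {0..b}"
  shows "y (u, 0) = x\<^sub>0 u"
  using assms unfolding classical_solution_def initial_boundary_conditions_def by auto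

lemma classical_solution_le_supersolution:
  assumes y: "classical_solution b \<epsilon> x\<^sub>0 y" and "0 < \<epsilon>" "0 \<le> b" "x\<^sub>0 0 = -1" "x\<^sub>0 b = 1"
    and S: "C21 0 b T S Su Suu St"
    and super: "\<And>u t. 0 < u \<Longrightarrow> u < b \<Longrightarrow> 0 < t \<Longrightarrow> t \<le> T \<Longrightarrow>
      Suu (u, t) - 1 \<le> St (u, t) * ((Su (u, t))\<^sup>2 + \<epsilon>)"
    and init: "\<And>u. 0 \<le> u \<Longrightarrow> u \<le> b \<Longrightarrow> x\<^sub>0 u \<le> S (u, 0)"
    and left: "\<And>t. 0 \<le> t \<Longrightarrow> t \<le> T \<Longrightarrow> -1 \<le> S (0, t)"
    and right: "\<And>t. 0 \<le> t \<Longrightarrow> t \<le> T \<Longrightarrow> 1 \<le> S (b, t)"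
    and "u \<in> {0..b}" "t \<in> {0..T}"
  shows "y (u, t) \<le> S (u, t)"
proof (rule comparison_principle[OF classical_solution_C21[OF y] S \<open>0 < \<epsilon>\<close> _ super])
  show "D\<^sub>t y (u, t) * ((D\<^sub>u b y (u, t))\<^sup>2 + \<epsilon>) \<le> D\<^sub>u b (D\<^sub>u b y) (u, t) - 1"
    if "0 < u" "u < b" "0 < t" for u t
    using classical_solution_equation[OF y \<open>0 < \<epsilon>\<close> that] by simp
  show "y (u, 0) \<le> S (u, 0)" if "0 \<le> u" "u \<le> b" for u
    using classical_solution_initial[OF y] init that by simp
  show "y (0, t) \<le> S (0, t)" "y (b, t) \<le> S (b, t)" if "0 \<le> t" "t \<le> T" for t
    using classical_solution_boundary[OF y assms(3-5) that(1)] left right that by simp_all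
qed (use assms in auto)

text \<open>A linear function is a supersolution because its defect is \<open>0 - 1 \<le> 0\<close>.
  The condition \<open>m * b \<le> 2\<close> keeps it above -1 at the left end.\<close>

lemma classical_solution_le_linear:
  assumes y: "classical_solution b \<epsilon> x\<^sub>0 y" and "0 < \<epsilon>" "0 < b" "x\<^sub>0 0 = -1" "x\<^sub>0 b = 1"
    and "0 \<le> m" "m * b \<le> 2"
    and init: "\<And>u. 0 \<le> u \<Longrightarrow> u \<le> b \<Longrightarrow> x\<^sub>0 u \<le> 1 - m * (b - u)"
    and u: "u \<in> {0..b}" and t: "0 \<le> t"
  shows "y (u, t) \<le> 1 - m * (b - u)"
proof -
  have "C21 0 b t (\<lambda>z. 1 - m * (b - fst z)) (\<lambda>_. m) (\<lambda>_. 0) (\<lambda>_. 0)"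
    unfolding C21_def by (auto intro!: continuous_intros derivative_eq_intros)
  from classical_solution_le_supersolution[OF y _ _ _ _ this, of u t] show ?thesis
    using assms by auto
qed

text \<open>The equation involves neither \<open>u\<close> nor the value of \<open>y\<close>, so
  \<open>y (u + h, t) - m * h\<close> is again a solution on \<open>[0, b - h]\<close> and can be
  compared with \<open>y\<close> itself.\<close>

lemma classical_solution_difference_ge:
  assumes y: "classical_solution b \<epsilon> x\<^sub>0 y" and \<epsilon>: "0 < \<epsilon>" and "x\<^sub>0 0 = -1" "x\<^sub>0 b = 1"
    and h: "0 < h" "h \<le> b" and m: "0 \<le> m" "m * b \<le> 2"
    and init: "\<And>u v. 0 \<le> u \<Longrightarrow> u \<le> v \<Longrightarrow> v \<le> b \<Longrightarrow> m * (v - u) \<le> x\<^sub>0 v - x\<^sub>0 u"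
    and left: "\<And>t. 0 \<le> t \<Longrightarrow> t \<le> T \<Longrightarrow> m * h - 1 \<le> y (h, t)"
    and ut: "0 \<le> u" "u + h \<le> b" "t \<in> {0..T}"
  shows "m * h \<le> y (u + h, t) - y (u, t)"
proof -
  note C = classical_solution_C21[OF y, of T]
  have y0: "C21 0 (b - h) T y (D\<^sub>u b y) (D\<^sub>u b (D\<^sub>u b y)) (D\<^sub>t y)"
    using C h unfolding C21_def by (auto elim!: continuous_on_subset)
  let ?\<tau> = "\<lambda>f z. f (fst z + h, snd z)"
  have yh: "C21 0 (b - h) T (\<lambda>z. ?\<tau> y z - m * h) (?\<tau> (D\<^sub>u b y)) (?\<tau> (D\<^sub>u b (D\<^sub>u b y))) (?\<tau> (D\<^sub>t y))"
    unfolding C21_def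
  proof (intro conjI allI impI)
    have "continuous_on ({0..b - h} \<times> {0..T}) (y \<circ> (\<lambda>z. (fst z + h, snd z)))"
      using C h unfolding C21_def
      by (intro continuous_on_compose continuous_intros) (auto elim!: continuous_on_subset)
    then show "continuous_on ({0..b - h} \<times> {0..T}) (\<lambda>z. ?\<tau> y z - m * h)"
      by (intro continuous_intros) (simp add: o_def)
  next
    fix v s assume vs: "0 < v \<and> v < b - h \<and> 0 < s \<and> s \<le> T"
    then have *: "0 < v + h" "v + h < b" using h by auto
    have d: "((\<lambda>v. y (v, s)) has_real_derivative D\<^sub>u b y (v + h, s)) (at (v + h))"
      "((\<lambda>v. D\<^sub>u b y (v, s)) has_real_derivative D\<^sub>u b (D\<^sub>u b y) (v + h, s)) (at (v + h))"
      "((\<lambda>s. y (v + h, s)) has_real_derivative D\<^sub>t y (v + h, s)) (at s)"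
      using C * vs unfolding C21_def by blast+
    note shift = d(1,2)[THEN DERIV_shift[THEN iffD1]]
    show "((\<lambda>v. ?\<tau> y (v, s) - m * h) has_real_derivative ?\<tau> (D\<^sub>u b y) (v, s)) (at v)"
      using DERIV_diff[OF shift(1) DERIV_const[of "m * h"]] by simp
    show "((\<lambda>v. ?\<tau> (D\<^sub>u b y) (v, s)) has_real_derivative ?\<tau> (D\<^sub>u b (D\<^sub>u b y)) (v, s)) (at v)"
      using shift(2) by simp
    show "((\<lambda>s. ?\<tau> y (v, s) - m * h) has_real_derivative ?\<tau> (D\<^sub>t y) (v, s)) (at s)"
      using DERIV_diff[OF d(3) DERIV_const[of "m * h"]] by simp
  qed
  \<comment> \<open>This is the ordering at the right end, where the translate equals
    \<open>y (b, s) - m * h = 1 - m * h\<close>.\<close>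
  have lin: "y (b - h, s) \<le> 1 - m * h" if "0 \<le> s" for s
  proof -
    have "y (b - h, s) \<le> 1 - m * (b - (b - h))"
    proof (rule classical_solution_le_linear[OF y \<epsilon>])
      show "x\<^sub>0 v \<le> 1 - m * (b - v)" if "0 \<le> v" "v \<le> b" for v
        using init[of v b] that \<open>x\<^sub>0 b = 1\<close> by simp
    qed (use assms that in auto)
    then show ?thesis by simp
  qed
  have "y (u, t) \<le> ?\<tau> y (u, t) - m * h"
  proof (rule comparison_principle[OF y0 yh \<epsilon>])
    show "y (v, 0) \<le> ?\<tau> y (v, 0) - m * h" if "0 \<le> v" "v \<le> b - h" for v
      using init[of v "v + h"] that h classical_solution_initial[OF y] by simp
    show "y (0, s) \<le> ?\<tau> y (0, s) - m * h" if "0 \<le> s" "s \<le> T" for s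
      using left[OF that] classical_solution_boundary[OF y] that assms(3-6) by simp
    show "y (b - h, s) \<le> ?\<tau> y (b - h, s) - m * h" if "0 \<le> s" "s \<le> T" for s
      using lin[of s] classical_solution_boundary[OF y] that assms(3-6) by simp
  qed (use classical_solution_equation[OF y \<epsilon>] h ut in auto)
  then show ?thesis by simp
qed

text \<open>The bound \<open>\<epsilon> \<le> E\<close> makes the time \<open>L / \<mu>\<close> independent of \<open>\<epsilon>\<close>.\<close>

lemma classical_solution_le_parabola:
  fixes b L E :: real
  defines "\<mu> \<equiv> (1 - 4 / b\<^sup>2) / (b * ((2 + L)\<^sup>2 + E))"
  assumes y: "classical_solution b \<epsilon> x\<^sub>0 y" and \<epsilon>: "0 < \<epsilon>" "\<epsilon> \<le> E" and b: "2 < b"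
    and x\<^sub>0: "x\<^sub>0 0 = -1" "x\<^sub>0 b = 1"
    and L: "0 < L" "\<And>u. 0 \<le> u \<Longrightarrow> u \<le> b \<Longrightarrow> x\<^sub>0 u \<le> L * u - 1"
    and u: "u \<in> {0..b}"
  shows "y (u, L / \<mu>) \<le> 2 * u\<^sup>2 / b\<^sup>2 - 1"
proof -
  \<comment> \<open>With \<open>c * b\<^sup>2 = 2\<close> the parabola alone joins -1 at 0 to 1 at
    \<open>b\<close>. The condition \<open>b > 2\<close> gives \<open>2 * c < 1\<close>, which
    leaves room for the barrier to decrease in time.\<close>
  define c where "c = 2 / b\<^sup>2"
  have c: "0 \<le> c" "2 * c < 1" "c * b\<^sup>2 = 2" "2 * c * b \<le> 2"
    using b power_strict_mono[of 2 b 2] by (auto simp: c_def field_simps power2_eq_square)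
  have K: "0 < (2 + L)\<^sup>2 + E" using \<epsilon> by (intro add_nonneg_pos) auto
  have \<mu>_eq: "\<mu> = (1 - 2 * c) / (b * ((2 + L)\<^sup>2 + E))" by (simp add: \<mu>_def c_def)
  have \<mu>: "0 < \<mu>" using b c K by (simp add: \<mu>_eq)
  let ?S = "\<lambda>z. c * (fst z)\<^sup>2 + (L - \<mu> * snd z) * fst z - 1"
  have S: "C21 0 b (L / \<mu>) ?S (\<lambda>z. 2 * c * fst z + (L - \<mu> * snd z)) (\<lambda>_. 2 * c) (\<lambda>z. - \<mu> * fst z)"
    unfolding C21_def by (auto intro!: continuous_intros derivative_eq_intros)
  have "y (u, L / \<mu>) \<le> ?S (u, L / \<mu>)"
  proof (rule classical_solution_le_supersolution[OF y _ _ _ _ S])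
    fix v t assume v: "0 < v" "v < b" and t: "0 < t" "t \<le> L / \<mu>"
    have \<mu>t: "0 \<le> L - \<mu> * t" "L - \<mu> * t \<le> L" using t \<mu> by (auto simp: field_simps)
    have "2 * c * v \<le> 2 * c * b" using v c by (intro mult_left_mono) auto
    also note c(4)
    finally have "(2 * c * v + (L - \<mu> * t))\<^sup>2 \<le> (2 + L)\<^sup>2"
      using c \<mu>t v by (intro power_mono add_mono add_nonneg_nonneg) auto
    \<comment> \<open>The slope of the barrier lies between 0 and \<open>2 + L\<close>; the value of
      \<open>\<mu>\<close> turns this worst case into exactly \<open>1 - 2 * c\<close>.\<close>
    then have "(\<mu> * v) * ((2 * c * v + (L - \<mu> * t))\<^sup>2 + \<epsilon>) \<le> (\<mu> * b) * ((2 + L)\<^sup>2 + E)"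
      using \<epsilon> v \<mu> by (intro mult_mono add_mono add_nonneg_nonneg) auto
    also have "\<dots> = 1 - 2 * c" using b K by (simp add: \<mu>_eq)
    finally show "2 * c - 1 \<le> - \<mu> * fst (v, t) *
        ((2 * c * fst (v, t) + (L - \<mu> * snd (v, t)))\<^sup>2 + \<epsilon>)"
      by simp
  next
    fix v assume v: "0 \<le> v" "v \<le> b"
    have "0 \<le> c * v\<^sup>2" using c by simp
    then show "x\<^sub>0 v \<le> ?S (v, 0)" using L(2)[OF v] by simp
  next
    fix t assume "0 \<le> t" "t \<le> L / \<mu>"
    \<comment> \<open>Up to time \<open>L / \<mu>\<close> the linear term is nonnegative, so the
      barrier stays above 1 at the right end.\<close>
    then have "0 \<le> (L - \<mu> * t) * b" using b \<mu> by (intro mult_nonneg_nonneg) (auto simp: field_simps)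
    then show "1 \<le> ?S (b, t)" using c by simp
  qed (use \<epsilon> b x\<^sub>0 u L \<mu> in auto)
  then show ?thesis using \<mu> by (simp add: c_def)
qed

section \<open>Consequences of Hoelder convergence\<close>

lemma holder_norm_ge_derivative:
  assumes "j \<le> k" "u \<in> {0..b}"
  shows "ennreal \<bar>(D b ^^ j) g u\<bar> \<le> holder_norm b k \<alpha> g"
proof -
  have "ennreal \<bar>(D b ^^ j) g u\<bar> \<le> (SUP u\<in>{0..b}. ennreal \<bar>(D b ^^ j) g u\<bar>)"
    using assms by (intro SUP_upper) auto
  also have "\<dots> \<le> (\<Sum>j\<le>k. SUP u\<in>{0..b}. ennreal \<bar>(D b ^^ j) g u\<bar>)"
    using assms by (intro member_le_sum) auto
  also have "\<dots> \<le> holder_norm b k \<alpha> g" unfolding holder_norm_def by simp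
  finally show ?thesis .
qed

lemma holder_norm_ge_quotient:
  assumes "u \<in> {0..b}" "v \<in> {0..b}" "u \<noteq> v"
  shows "ennreal (\<bar>(D b ^^ k) g u - (D b ^^ k) g v\<bar> / \<bar>u - v\<bar> powr \<alpha>) \<le> holder_norm b k \<alpha> g"
proof -
  have "ennreal (\<bar>(D b ^^ k) g u - (D b ^^ k) g v\<bar> / \<bar>u - v\<bar> powr \<alpha>) \<le>
    (SUP u\<in>{0..b}. SUP v\<in>{0..b} - {u}.
      ennreal (\<bar>(D b ^^ k) g u - (D b ^^ k) g v\<bar> / \<bar>u - v\<bar> powr \<alpha>))"
    using assms by (intro SUP_upper2[of u] SUP_upper2[of v]) auto
  also have "\<dots> \<le> holder_norm b k \<alpha> g" unfolding holder_norm_def by simp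
  finally show ?thesis .
qed

text \<open>Finiteness of the seminorm bounds the oscillation by
  \<open>C * \<bar>u - v\<bar> powr \<alpha>\<close>, which vanishes as \<open>v\<close> tends to
  \<open>u\<close>.\<close>

lemma holder_space_continuous_on_derivative:
  assumes "g \<in> holder_space b k \<alpha>" "0 < \<alpha>"
  shows "continuous_on {0..b} ((D b ^^ k) g)"
proof -
  define C where "C = enn2real (holder_norm b k \<alpha> g)"
  have C: "holder_norm b k \<alpha> g = ennreal C"
    using assms by (simp add: C_def holder_space_def)
  have bound: "\<bar>(D b ^^ k) g u - (D b ^^ k) g v\<bar> \<le> C * \<bar>u - v\<bar> powr \<alpha>"
    if "u \<in> {0..b}" "v \<in> {0..b}" for u v
  proof (cases "u = v")
    case False
    have "\<bar>(D b ^^ k) g u - (D b ^^ k) g v\<bar> / \<bar>u - v\<bar> powr \<alpha> \<le> C"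
      using holder_norm_ge_quotient[OF that False, of k g \<alpha>] unfolding C
      by (simp add: C_def)
    then show ?thesis using False by (simp add: field_simps)
  qed simp
  show ?thesis
    unfolding continuous_on_def
  proof
    fix u assume u: "u \<in> {0..b}"
    have "((\<lambda>v. C * \<bar>v - u\<bar> powr \<alpha>) \<longlongrightarrow> C * \<bar>u - u\<bar> powr \<alpha>) (at u within {0..b})"
      using \<open>0 < \<alpha>\<close> by (intro tendsto_intros tendsto_powr') auto
    then have *: "((\<lambda>v. C * \<bar>v - u\<bar> powr \<alpha>) \<longlongrightarrow> 0) (at u within {0..b})"
      by simp
    have "((\<lambda>v. (D b ^^ k) g v - (D b ^^ k) g u) \<longlongrightarrow> 0) (at u within {0..b})"
      by (rule Lim_null_comparison[OF _ *]) (use bound u in \<open>auto simp: eventually_at intro!: exI[of _ 1]\<close>)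
    then show "((D b ^^ k) g \<longlongrightarrow> (D b ^^ k) g u) (at u within {0..b})"
      by (rule LIM_zero_cancel)
  qed
qed

section \<open>The derivative on \<open>[0, b]\<close> and joint continuity of the space
  derivative\<close>

lemma has_derivative_D:
  assumes "g differentiable_on {0..b}" "u \<in> {0..b}"
  shows "(g has_real_derivative D b g u) (at u within {0..b})"
  using assms
  by (auto simp: D_def differentiable_on_def vector_derivative_works
      has_real_derivative_iff_has_vector_derivative)

lemma D_eqI:
  assumes "0 < b" "u \<in> {0..b}" "(g has_real_derivative d) (at u within {0..b})"
  shows "D b g u = d"
  unfolding D_def using assms
  by (intro vector_derivative_within at_within_Icc_neq_bot)
    (auto simp: has_real_derivative_iff_has_vector_derivative)

lemma D_cong:
  assumes "\<And>u. u \<in> {0..b} \<Longrightarrow> f u = g u" "u \<in> {0..b}"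
  shows "D b f u = D b g u"
proof -
  have "(f has_vector_derivative d) (at u within {0..b}) \<longleftrightarrow>
      (g has_vector_derivative d) (at u within {0..b})" for d
    using assms by (intro has_vector_derivative_cong_ev) auto
  then show ?thesis by (simp add: D_def vector_derivative_def)
qed

lemma C0_holder_has_derivative:
  assumes "f \<in> C0_holder b 1 \<alpha>" "u \<in> {0..b}" "0 \<le> t"
  shows "((\<lambda>v. f (v, t)) has_real_derivative D\<^sub>u b f (u, t)) (at u within {0..b})"
  using assms unfolding D\<^sub>u_def
  by (auto simp: C0_holder_def holder_space_def intro!: has_derivative_D)

text \<open>Hoelder regularity gives continuity in \<open>u\<close> at fixed \<open>t\<close>, and
  the norm gives continuity in time uniformly in \<open>u\<close>. The two are joined by the
  triangle inequality through \<open>(v, t)\<close>.\<close>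

lemma C0_holder_continuous_on_D\<^sub>u:
  assumes f: "f \<in> C0_holder b 1 \<alpha>" and "0 < \<alpha>" "0 < b"
  shows "continuous_on ({0..b} \<times> {0..}) (D\<^sub>u b f)"
  unfolding continuous_on_iff
proof (intro ballI allI impI)
  fix e :: real and z :: "real \<times> real"
  assume z: "z \<in> {0..b} \<times> {0..}" and e: "0 < e"
  obtain u t where ut: "z = (u, t)" "u \<in> {0..b}" "0 \<le> t" using z by (cases z) auto
  have "(\<lambda>u. f (u, t)) \<in> holder_space b 1 \<alpha>" using f ut by (auto simp: C0_holder_def)
  from holder_space_continuous_on_derivative[OF this \<open>0 < \<alpha>\<close>]
  have "continuous_on {0..b} (\<lambda>v. D\<^sub>u b f (v, t))" by (simp add: D\<^sub>u_def)
  then obtain d\<^sub>1 where d\<^sub>1: "0 < d\<^sub>1"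
    "\<And>v. v \<in> {0..b} \<Longrightarrow> dist v u < d\<^sub>1 \<Longrightarrow> dist (D\<^sub>u b f (v, t)) (D\<^sub>u b f (u, t)) < e / 2"
    using ut e unfolding continuous_on_iff by (meson half_gt_zero)
  have "((\<lambda>s. holder_norm b 1 \<alpha> (\<lambda>u. f (u, s) - f (u, t))) \<longlongrightarrow> 0) (at t within {0..})"
    using f ut by (auto simp: C0_holder_def)
  then have "\<forall>\<^sub>F s in at t within {0..}. holder_norm b 1 \<alpha> (\<lambda>u. f (u, s) - f (u, t)) < ennreal (e / 2)"
    using e by (intro order_tendstoD(2)) auto
  then obtain d\<^sub>2 where d\<^sub>2: "0 < d\<^sub>2" "\<And>s. 0 \<le> s \<Longrightarrow> s \<noteq> t \<Longrightarrow> dist s t < d\<^sub>2 \<Longrightarrow>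
      holder_norm b 1 \<alpha> (\<lambda>u. f (u, s) - f (u, t)) < ennreal (e / 2)"
    unfolding eventually_at by auto
  have time: "dist (D\<^sub>u b f (v, s)) (D\<^sub>u b f (v, t)) < e / 2"
    if v: "v \<in> {0..b}" and s: "0 \<le> s" "dist s t < d\<^sub>2" for v s
  \<comment> \<open>The limit in time is punctured, so \<open>s = t\<close> is treated
    separately.\<close>
  proof (cases "s = t")
    case False
    have "D b (\<lambda>u. f (u, s) - f (u, t)) v = D\<^sub>u b f (v, s) - D\<^sub>u b f (v, t)"
      using C0_holder_has_derivative[OF f v] s ut \<open>0 < b\<close> v
      by (intro D_eqI derivative_intros) auto
    moreover have "ennreal \<bar>(D b ^^ 1) (\<lambda>u. f (u, s) - f (u, t)) v\<bar> < ennreal (e / 2)"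
      using holder_norm_ge_derivative[of 1 1 v b] d\<^sub>2(2)[OF s(1) False s(2)] v
      by (meson le_refl order_le_less_trans)
    ultimately show ?thesis by (simp add: dist_real_def ennreal_less_iff)
  qed (use e in auto)
  show "\<exists>d>0. \<forall>x'\<in>{0..b} \<times> {0..}. dist x' z < d \<longrightarrow> dist (D\<^sub>u b f x') (D\<^sub>u b f z) < e"
  proof (intro exI[of _ "min d\<^sub>1 d\<^sub>2"] conjI ballI impI)
    fix x' assume x': "x' \<in> {0..b} \<times> {0..}" "dist x' z < min d\<^sub>1 d\<^sub>2"
    obtain v s where vs: "x' = (v, s)" "v \<in> {0..b}" "0 \<le> s" using x' by (cases x') auto
    have "dist v u < d\<^sub>1" "dist s t < d\<^sub>2"
      using x'(2) dist_fst_le[of x' z] dist_snd_le[of x' z] vs ut by auto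
    then have "dist (D\<^sub>u b f (v, s)) (D\<^sub>u b f (v, t)) < e / 2"
      "dist (D\<^sub>u b f (v, t)) (D\<^sub>u b f (u, t)) < e / 2"
      using time d\<^sub>1 vs by auto
    then show "dist (D\<^sub>u b f x') (D\<^sub>u b f z) < e"
      using vs ut dist_triangle_half_l[of _ "D\<^sub>u b f (v, t)" e] by (metis dist_commute)
  qed (use d\<^sub>1 d\<^sub>2 in auto)
qed

text \<open>The summand \<open>j = 0\<close> of the Hoelder norm is the supremum norm.\<close>

lemma C0_holder_tendsto_uniform:
  assumes "C0_holder_tendsto b k \<alpha> y x" "0 < T" "0 < e"
  shows "\<forall>\<^sub>F n in sequentially. \<forall>u\<in>{0..b}. \<forall>t\<in>{0..T}. \<bar>y n (u, t) - x (u, t)\<bar> < e"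
proof -
  have "(\<lambda>n. SUP t\<in>{0..T}. holder_norm b k \<alpha> (\<lambda>u. y n (u, t) - x (u, t))) \<longlonglongrightarrow> 0"
    using assms unfolding C0_holder_tendsto_def by auto
  then have "\<forall>\<^sub>F n in sequentially.
      (SUP t\<in>{0..T}. holder_norm b k \<alpha> (\<lambda>u. y n (u, t) - x (u, t))) < ennreal e"
    using assms by (intro order_tendstoD(2)) auto
  then show ?thesis
  proof eventually_elim
    case (elim n)
    show ?case
    proof (intro ballI)
      fix u t assume ut: "u \<in> {0..b}" "t \<in> {0..T}"
      have "ennreal \<bar>y n (u, t) - x (u, t)\<bar> \<le> holder_norm b k \<alpha> (\<lambda>u. y n (u, t) - x (u, t))"
        using holder_norm_ge_derivative[of 0 k u b "\<lambda>u. y n (u, t) - x (u, t)" \<alpha>] ut by simp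
      also have "\<dots> \<le> (SUP t\<in>{0..T}. holder_norm b k \<alpha> (\<lambda>u. y n (u, t) - x (u, t)))"
        using ut by (intro SUP_upper) auto
      also note elim
      finally show "\<bar>y n (u, t) - x (u, t)\<bar> < e" by (simp add: ennreal_less_iff)
    qed
  qed
qed

lemma C0_holder_tendsto_pointwise:
  assumes "C0_holder_tendsto b k \<alpha> y x" "u \<in> {0..b}" "0 \<le> t"
  shows "(\<lambda>n. y n (u, t)) \<longlonglongrightarrow> x (u, t)"
proof (rule tendstoI)
  fix e :: real assume "0 < e"
  show "\<forall>\<^sub>F n in sequentially. dist (y n (u, t)) (x (u, t)) < e"
    \<comment> \<open>The horizon \<open>t + 1\<close> is positive even for
      \<open>t = 0\<close>.\<close>
    using C0_holder_tendsto_uniform[OF assms(1) _ \<open>0 < e\<close>, of "t + 1"] assms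
    by (auto elim!: eventually_mono simp: dist_real_def)
qed

section \<open>The first zero of the space derivative\<close>

text \<open>Fixes one regularizing sequence, one Hoelder exponent and bounds
  \<open>m\<^sub>0\<close>, \<open>L\<close> on the initial slope, from which the constants of the
  barriers are built.\<close>

locale regularization_limit =
  fixes b :: real and x\<^sub>0 :: "real \<Rightarrow> real" and x :: "real \<times> real \<Rightarrow> real"
    and \<epsilon> :: "nat \<Rightarrow> real" and y :: "nat \<Rightarrow> real \<times> real \<Rightarrow> real" and m\<^sub>0 L \<alpha> :: real
  assumes b: "2 < b"
    and x\<^sub>0_left: "x\<^sub>0 0 = -1" and x\<^sub>0_right: "x\<^sub>0 b = 1"
    and x\<^sub>0_deriv: "\<And>u. u \<in> {0..b} \<Longrightarrow> (x\<^sub>0 has_real_derivative D b x\<^sub>0 u) (at u within {0..b})"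
    and m\<^sub>0_pos: "0 < m\<^sub>0"
    and D_x\<^sub>0: "\<And>u. u \<in> {0..b} \<Longrightarrow> m\<^sub>0 \<le> D b x\<^sub>0 u" "\<And>u. u \<in> {0..b} \<Longrightarrow> D b x\<^sub>0 u \<le> L"
    and \<epsilon>_pos: "\<And>k. 0 < \<epsilon> k" and \<epsilon>_decseq: "decseq \<epsilon>"
    and y: "\<And>k. classical_solution b (\<epsilon> k) x\<^sub>0 (y k)"
    and \<alpha>: "0 < \<alpha>" and y_tendsto: "C0_holder_tendsto b 1 \<alpha> y x"
    and x_conditions: "initial_boundary_conditions b x\<^sub>0 x"
begin

lemma x_C0_holder: "x \<in> C0_holder b 1 \<alpha>"
  using y_tendsto by (simp add: C0_holder_tendsto_def)

lemmas x_deriv = C0_holder_has_derivative[OF x_C0_holder]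

lemma continuous_on_x\<^sub>u: "continuous_on ({0..b} \<times> {0..}) (D\<^sub>u b x)"
  using C0_holder_continuous_on_D\<^sub>u[OF x_C0_holder \<alpha>] b by simp

lemma x_left: "0 \<le> t \<Longrightarrow> x (0, t) = -1"
  using x_conditions x\<^sub>0_left b unfolding initial_boundary_conditions_def by (cases "t = 0") auto

lemma x\<^sub>u_initial: "u \<in> {0..b} \<Longrightarrow> D\<^sub>u b x (u, 0) = D b x\<^sub>0 u"
  using x_conditions unfolding initial_boundary_conditions_def D\<^sub>u_def by (auto intro!: D_cong)

lemma x\<^sub>0_difference_ge: "0 \<le> u \<Longrightarrow> u \<le> v \<Longrightarrow> v \<le> b \<Longrightarrow> m\<^sub>0 * (v - u) \<le> x\<^sub>0 v - x\<^sub>0 u"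
  by (rule difference_ge_of_derivative_ge[OF x\<^sub>0_deriv]) (auto intro: D_x\<^sub>0)

lemma x\<^sub>0_le: "0 \<le> u \<Longrightarrow> u \<le> b \<Longrightarrow> x\<^sub>0 u \<le> L * u - 1"
  using difference_ge_of_derivative_ge[OF DERIV_minus[OF x\<^sub>0_deriv], of 0 u "- L"]
    D_x\<^sub>0(2) x\<^sub>0_left
  by auto

lemma L_pos: "0 < L"
  using m\<^sub>0_pos D_x\<^sub>0[of 0] b by auto

text \<open>The parabolic bound survives the limit and touches \<open>x\<close> at
  \<open>u = 0\<close> with slope 0, so the slope of \<open>x\<close> there has become nonpositive.
  It started positive, hence vanished in between.\<close>

lemma ex_zero: "\<exists>t>0. D\<^sub>u b x (0, t) = 0"
proof -
  \<comment> \<open>As the sequence decreases, \<open>\<epsilon> 0\<close> bounds every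
    \<open>\<epsilon> k\<close>, and one time serves all \<open>k\<close>.\<close>
  define T where "T = L / ((1 - 4 / b\<^sup>2) / (b * ((2 + L)\<^sup>2 + \<epsilon> 0)))"
  have "4 / b\<^sup>2 < 1" using b power_strict_mono[of 2 b 2] by (simp add: field_simps)
  moreover have "0 < (2 + L)\<^sup>2 + \<epsilon> 0" using \<epsilon>_pos by (intro add_nonneg_pos) auto
  ultimately have T: "0 < T" using b L_pos by (simp add: T_def)
  have "x (u, T) \<le> 2 * u\<^sup>2 / b\<^sup>2 - 1" if u: "u \<in> {0..b}" for u
  proof (rule LIMSEQ_le_const2)
    show "(\<lambda>k. y k (u, T)) \<longlonglongrightarrow> x (u, T)"
      using C0_holder_tendsto_pointwise[OF y_tendsto u] T by simp
    have "y k (u, T) \<le> 2 * u\<^sup>2 / b\<^sup>2 - 1" for k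
      unfolding T_def
      by (rule classical_solution_le_parabola[OF y \<epsilon>_pos _ b x\<^sub>0_left x\<^sub>0_right L_pos x\<^sub>0_le u])
        (use \<epsilon>_decseq in \<open>auto simp: decseq_def\<close>)
    then show "\<exists>N. \<forall>k\<ge>N. y k (u, T) \<le> 2 * u\<^sup>2 / b\<^sup>2 - 1" by auto
  qed
  moreover have "((\<lambda>u. 2 * u\<^sup>2 / b\<^sup>2 - 1) has_real_derivative 0) (at 0 within {0..b})"
    using b by (auto intro!: derivative_eq_intros)
  ultimately have "D\<^sub>u b x (0, T) \<le> 0"
    using derivative_le_at_0[OF _ x_deriv] x_left[of T] T b by simp
  moreover have "0 < D\<^sub>u b x (0, 0)" using x\<^sub>u_initial D_x\<^sub>0(1)[of 0] m\<^sub>0_pos b by auto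
  moreover have "continuous_on {0..T} (\<lambda>t. D\<^sub>u b x (0, t))"
    by (rule continuous_on_compose2[OF continuous_on_x\<^sub>u]) (use b in \<open>auto intro!: continuous_intros\<close>)
  ultimately obtain t where "0 \<le> t" "D\<^sub>u b x (0, t) = 0"
    using IVT2'[of "\<lambda>t. D\<^sub>u b x (0, t)" T 0 0] T by auto
  with \<open>0 < D\<^sub>u b x (0, 0)\<close> show ?thesis by (intro exI[of _ t]) (cases "t = 0"; auto)
qed

text \<open>Positivity at \<open>u = 0\<close> extends to a strip near the left end, which yields
  the left ordering for \<open>y k\<close> with large \<open>k\<close>. Increments, not slopes, are
  then passed to the limit, and the slope bound is recovered from them.\<close>

lemma x\<^sub>u_lower_bound:
  assumes T: "0 < T" and pos: "\<And>t. t \<in> {0..T} \<Longrightarrow> 0 < D\<^sub>u b x (0, t)"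
  obtains m where "0 < m" "\<And>u t. u \<in> {0..b} \<Longrightarrow> t \<in> {0..T} \<Longrightarrow> m \<le> D\<^sub>u b x (u, t)"
proof -
  have "continuous_on {0..T} (\<lambda>t. D\<^sub>u b x (0, t))"
    by (rule continuous_on_compose2[OF continuous_on_x\<^sub>u]) (use b in \<open>auto intro!: continuous_intros\<close>)
  then obtain s where s: "s \<in> {0..T}" "\<And>t. t \<in> {0..T} \<Longrightarrow> D\<^sub>u b x (0, s) \<le> D\<^sub>u b x (0, t)"
    using continuous_attains_inf[of "{0..T}" "\<lambda>t. D\<^sub>u b x (0, t)"] T by auto
  define \<delta> where "\<delta> = D\<^sub>u b x (0, s)"
  have \<delta>: "0 < \<delta>" using pos s by (simp add: \<delta>_def)
  have "uniformly_continuous_on ({0..b} \<times> {0..T}) (D\<^sub>u b x)"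
    by (intro compact_uniformly_continuous compact_Times compact_Icc
        continuous_on_subset[OF continuous_on_x\<^sub>u]) auto
  then obtain d where d: "0 < d" "\<And>z z'. z \<in> {0..b} \<times> {0..T} \<Longrightarrow> z' \<in> {0..b} \<times> {0..T} \<Longrightarrow>
      dist z' z < d \<Longrightarrow> dist (D\<^sub>u b x z') (D\<^sub>u b x z) < \<delta> / 2"
    using \<delta> unfolding uniformly_continuous_on_def by (meson half_gt_zero)
  define h\<^sub>0 where "h\<^sub>0 = min (d / 2) b"
  have h\<^sub>0: "0 < h\<^sub>0" "h\<^sub>0 < d" "h\<^sub>0 \<le> b" using d b by (auto simp: h\<^sub>0_def)
  have near: "\<delta> / 2 \<le> D\<^sub>u b x (u, t)" if "u \<in> {0..h\<^sub>0}" "t \<in> {0..T}" for u t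
  proof -
    have "\<bar>D\<^sub>u b x (u, t) - D\<^sub>u b x (0, t)\<bar> < \<delta> / 2"
      using d(2)[of "(0, t)" "(u, t)"] that h\<^sub>0 by (auto simp: dist_Pair_Pair dist_real_def)
    then show ?thesis using s(2)[OF that(2)] unfolding \<delta>_def by linarith
  qed
  \<comment> \<open>The three bounds serve the initial ordering, the linear barrier and the left
    ordering. In the last, the slope \<open>\<delta> / 2\<close> of \<open>x\<close> in the strip
    leaves \<open>\<delta> / 4\<close> for the approximation error.\<close>
  define m where "m = min (min m\<^sub>0 (2 / b)) (\<delta> / 4)"
  have m: "0 < m" "m \<le> m\<^sub>0" "m \<le> 2 / b" "m \<le> \<delta> / 4"
    using m\<^sub>0_pos b \<delta> by (auto simp: m_def)
  have mb: "m * b \<le> 2" using m(3) b by (simp add: field_simps)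
  have diff: "m * h \<le> x (u + h, t) - x (u, t)"
    if h: "0 < h" "h \<le> h\<^sub>0" and u: "0 \<le> u" "u + h \<le> b" and t: "t \<in> {0..T}" for h u t
  proof (rule tendsto_lowerbound)
    show "(\<lambda>k. y k (u + h, t) - y k (u, t)) \<longlonglongrightarrow> x (u + h, t) - x (u, t)"
      using u h t by (intro tendsto_diff C0_holder_tendsto_pointwise[OF y_tendsto]) auto
    \<comment> \<open>The tolerance, and with it the threshold for \<open>k\<close>, depends on
      \<open>h\<close>; this is harmless because \<open>h\<close> is fixed while \<open>k\<close>
      tends to infinity.\<close>
    have "0 < \<delta> / 4 * h" using \<delta> h by simp
    from C0_holder_tendsto_uniform[OF y_tendsto T this]
    show "\<forall>\<^sub>F k in sequentially. m * h \<le> y k (u + h, t) - y k (u, t)"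
    proof eventually_elim
      case (elim k)
      show ?case
      proof (rule classical_solution_difference_ge[OF y \<epsilon>_pos x\<^sub>0_left x\<^sub>0_right h(1)])
        show "m * (w - v) \<le> x\<^sub>0 w - x\<^sub>0 v" if "0 \<le> v" "v \<le> w" "w \<le> b" for v w
          using x\<^sub>0_difference_ge[OF that] mult_right_mono[OF m(2), of "w - v"] that by linarith
        show "m * h - 1 \<le> y k (h, s)" if s: "0 \<le> s" "s \<le> T" for s
        proof -
          have "\<delta> / 2 * (h - 0) \<le> x (h, s) - x (0, s)"
            by (rule difference_ge_of_derivative_ge[OF x_deriv]) (use s h h\<^sub>0 near in auto)
          moreover have "\<bar>y k (h, s) - x (h, s)\<bar> < \<delta> / 4 * h" using elim s h h\<^sub>0 by auto
          moreover have "m * h \<le> \<delta> / 4 * h" using m(4) h by (intro mult_right_mono) auto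
          ultimately show ?thesis using x_left[OF s(1)] unfolding abs_less_iff by (simp add: field_simps)
        qed
      qed (use h h\<^sub>0 m mb u t in auto)
    qed
  qed simp
  have "m \<le> D\<^sub>u b x (u, t)" if "u \<in> {0..b}" "t \<in> {0..T}" for u t
    by (rule derivative_ge_of_difference_ge[OF _ that(1) x_deriv h\<^sub>0(1)])
      (use that b diff in auto)
  with m(1) show thesis using that by blast
qed

text \<open>The zeros up to a known zero time form a nonempty compact set, so an earliest one
  exists, at an unknown place. Were the slope at \<open>u = 0\<close> nonzero at that time, it would
  be positive up to then, and the lower bound would exclude zeros everywhere.\<close>

lemma first_zero:
  obtains T where "0 < T" "D\<^sub>u b x (0, T) = 0"
    "\<And>u t. u \<in> {0..b} \<Longrightarrow> 0 < t \<Longrightarrow> D\<^sub>u b x (u, t) = 0 \<Longrightarrow> T \<le> t"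
proof -
  obtain t\<^sub>1 where t\<^sub>1: "0 < t\<^sub>1" "D\<^sub>u b x (0, t\<^sub>1) = 0" using ex_zero by auto
  define Z where "Z = {z \<in> {0..b} \<times> {0..t\<^sub>1}. D\<^sub>u b x z = 0}"
  have "closed Z"
    unfolding Z_def
    by (intro continuous_closed_preimage_constant closed_Times closed_atLeastAtMost
        continuous_on_subset[OF continuous_on_x\<^sub>u]) auto
  then have "compact (({0..b} \<times> {0..t\<^sub>1}) \<inter> Z)"
    by (intro compact_Int_closed compact_Times compact_Icc)
  moreover have "({0..b} \<times> {0..t\<^sub>1}) \<inter> Z = Z" by (auto simp: Z_def)
  moreover have "(0, t\<^sub>1) \<in> Z" using t\<^sub>1 b by (auto simp: Z_def)
  ultimately have "compact Z" "Z \<noteq> {}" by auto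
  then obtain z where z: "z \<in> Z" "\<And>z'. z' \<in> Z \<Longrightarrow> snd z \<le> snd z'"
    using continuous_attains_inf[of Z snd] continuous_on_snd[OF continuous_on_id, of Z] by blast
  define T where "T = snd z"
  have initial_pos: "0 < D\<^sub>u b x (u, 0)" if "u \<in> {0..b}" for u
    using x\<^sub>u_initial[OF that] D_x\<^sub>0(1)[OF that] m\<^sub>0_pos by simp
  have zT: "fst z \<in> {0..b}" "0 \<le> T" "T \<le> t\<^sub>1" "D\<^sub>u b x (fst z, T) = 0"
    using z(1) by (auto simp: Z_def T_def)
  then have T: "0 < T" using initial_pos[of "fst z"] by (cases "T = 0") auto
  \<comment> \<open>Times beyond \<open>t\<^sub>1\<close> lie outside \<open>Z\<close> but exceed
    \<open>T\<close> anyway.\<close>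
  have first: "T \<le> t" if "u \<in> {0..b}" "0 \<le> t" "D\<^sub>u b x (u, t) = 0" for u t
    using z(2)[of "(u, t)"] that zT(3) by (cases "t \<le> t\<^sub>1") (auto simp: Z_def T_def)
  have "D\<^sub>u b x (0, T) = 0"
  proof (rule ccontr)
    assume nz: "D\<^sub>u b x (0, T) \<noteq> 0"
    \<comment> \<open>A nonpositive value would force a zero at some \<open>s \<le> t\<close>;
      minimality makes \<open>s = T\<close>, contrary to \<open>nz\<close>.\<close>
    have pos: "0 < D\<^sub>u b x (0, t)" if t: "t \<in> {0..T}" for t
    proof (rule ccontr)
      assume "\<not> 0 < D\<^sub>u b x (0, t)"
      moreover have "continuous_on {0..t} (\<lambda>t. D\<^sub>u b x (0, t))"
        by (rule continuous_on_compose2[OF continuous_on_x\<^sub>u]) (use b in \<open>auto intro!: continuous_intros\<close>)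
      ultimately obtain s where s: "0 \<le> s" "s \<le> t" "D\<^sub>u b x (0, s) = 0"
        using IVT2'[of "\<lambda>t. D\<^sub>u b x (0, t)" t 0 0] t initial_pos[of 0] b by auto
      then have "s = T" using first[of 0 s] t b by auto
      with s nz show False by simp
    qed
    obtain m where "0 < m" "\<And>u t. u \<in> {0..b} \<Longrightarrow> t \<in> {0..T} \<Longrightarrow> m \<le> D\<^sub>u b x (u, t)"
      using x\<^sub>u_lower_bound[OF T pos] by blast
    from this(1) this(2)[OF zT(1), of T] show False using zT(2,4) by simp
  qed
  with T first show thesis using that less_imp_le by blast
qed

end

text \<open>The infimum is taken in the extended reals, where the empty set has infimum infinity, so
  finiteness includes the existence of a zero.\<close>

theorem theorem1p5:
  fixes b \<beta> :: real and x\<^sub>0 :: "real \<Rightarrow> real" and x :: "real \<times> real \<Rightarrow> real"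
  assumes "2 < b"
    and "0 < \<beta>" and "\<beta> < 1"
    and "x\<^sub>0 \<in> holder_space b 2 \<beta>"
    and "x\<^sub>0 0 = -1" and "x\<^sub>0 b = 1"
    and "D b (D b x\<^sub>0) 0 = 0" and "D b (D b x\<^sub>0) b = b"
    and "\<forall>u\<in>{0..b}. 0 < D b x\<^sub>0 u"
    and "constructed_solution b x\<^sub>0 x"
  shows "(let t\<^sub>0 = Inf (ereal ` {t. 0 < t \<and> (\<exists>u\<in>{0..b}. D\<^sub>u b x (u, t) = 0)})
          in t\<^sub>0 \<in> {0<..<\<infinity>} \<and> D\<^sub>u b x (0, real_of_ereal t\<^sub>0) = 0) \<and>
         (\<forall>\<^sub>F t in at_top. \<exists>y\<in>(\<lambda>u. x (u, t)) ` {0..b}. y < 0)"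
proof -
  from assms(10) obtain \<epsilon> y where y: "\<forall>k. 0 < \<epsilon> k" "decseq \<epsilon>"
      "\<forall>k. classical_solution b (\<epsilon> k) x\<^sub>0 (y k)"
      "\<forall>\<alpha>\<in>{0<..<1}. C0_holder_tendsto b 1 \<alpha> y x" "initial_boundary_conditions b x\<^sub>0 x"
    unfolding constructed_solution_def weak_solution_def by blast
  have diff: "(D b ^^ j) x\<^sub>0 differentiable_on {0..b}" if "j < 2" for j
    using assms(4) that by (simp add: holder_space_def)
  have "continuous_on {0..b} (D b x\<^sub>0)"
    using diff[of 1] by (simp add: differentiable_imp_continuous_on)
  then obtain u\<^sub>1 u\<^sub>2 where u: "u\<^sub>1 \<in> {0..b}" "u\<^sub>2 \<in> {0..b}"
    "\<And>u. u \<in> {0..b} \<Longrightarrow> D b x\<^sub>0 u\<^sub>1 \<le> D b x\<^sub>0 u" "\<And>u. u \<in> {0..b} \<Longrightarrow> D b x\<^sub>0 u \<le> D b x\<^sub>0 u\<^sub>2"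
    using continuous_attains_inf[of "{0..b}" "D b x\<^sub>0"] continuous_attains_sup[of "{0..b}" "D b x\<^sub>0"]
      assms(1) by auto
  \<comment> \<open>The slope bounds are the attained minimum and maximum of the initial slope; the
    exponent \<open>1 / 2\<close> is an arbitrary choice in (0,1).\<close>
  interpret regularization_limit b x\<^sub>0 x \<epsilon> y "D b x\<^sub>0 u\<^sub>1" "D b x\<^sub>0 u\<^sub>2" "1 / 2"
    using assms(1,5,6,9) y u has_derivative_D[of x\<^sub>0 b] diff[of 0] by unfold_locales auto
  obtain T where T: "0 < T" "D\<^sub>u b x (0, T) = 0"
    "\<And>u t. u \<in> {0..b} \<Longrightarrow> 0 < t \<Longrightarrow> D\<^sub>u b x (u, t) = 0 \<Longrightarrow> T \<le> t"
    using first_zero by blast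
  have "Inf (ereal ` {t. 0 < t \<and> (\<exists>u\<in>{0..b}. D\<^sub>u b x (u, t) = 0)}) = ereal T"
    using T assms(1) by (intro antisym Inf_greatest Inf_lower) (auto intro!: imageI bexI[of _ 0])
  \<comment> \<open>The boundary value -1 at \<open>u = 0\<close> is the negative element.\<close>
  moreover have "\<forall>\<^sub>F t in at_top. \<exists>y\<in>(\<lambda>u. x (u, t)) ` {0..b}. y < 0"
    using eventually_ge_at_top[of "0::real"]
    by eventually_elim (use x_left assms(1) in \<open>auto intro!: bexI[of _ 0]\<close>)
  ultimately show ?thesis using T by simp
qed

end
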